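(* Let $k\ge 1$ and $n=p_1\cdots p_k$ with $p_1<\cdots<p_k$ odd primes, and let $\delta^-(n)=2\frac{n}{p_1}-\psi(n)$. (1) If $\delta^-(n)\ge\frac12\frac{n}{p_1}$, then $g(\Psi_n)=\delta^-(n)$. (2) For every $k\ge2$ and every odd prime $p$, \[ \lim_{b\to\infty}\frac{\#\{n: p_k\le b,\ p_1=p,\ \delta^-(n)\ge\frac12\frac{n}{p_1}\}}{\#\{n: p_k\le b,\ p_1=p\}}=1, \] where $n$ ranges over products $p_1\cdots p_k$ of $k$ odd primes $p_1<\cdots<p_k$.
   Context: $\Psi_n(x)=\prod_{1\le j\le n,\ \gcd(j,n)\ne1}(x-e^{2\pi i j/n})$ is the $n$-th inverse cyclotomic polynomial and $\psi(n)=\deg\Psi_n=n-\varphi(n)$ with $\varphi$ Euler's totient. For a polynomial $f=c_1x^{\nu_1}+\cdots+c_tx^{\nu_t}$ with all $c_i\ne0$, $0\le\nu_1<\cdots<\nu_t$, the maximum gap is $g(f)=\max_{1\le i<t}(\nu_{i+1}-\nu_i)$ if $t\ne1$ and $g(f)=0$ if $t=1$. *)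

theory Defs
  imports
    Complex_Main
    "HOL-Computational_Algebra.Polynomial"
    "HOL-Computational_Algebra.Primes"
    "HOL-Number_Theory.Totient"
begin

definition inv_cyclotomic :: "nat \<Rightarrow> complex poly" where
  "inv_cyclotomic n =
     (\<Prod>j | 1 \<le> j \<and> j \<le> n \<and> gcd j n \<noteq> 1.
        [:- exp (2 * of_real pi * \<i> * of_nat j / of_nat n), 1:])"

definition psi :: "nat \<Rightarrow> nat" where
  "psi n = degree (inv_cyclotomic n)"

lemma psi_eq_minus_totient:
  assumes "n \<ge> 1"
  shows "psi n = n - totient n"
proof -
  define A where "A = {j. 1 \<le> j \<and> j \<le> n \<and> gcd j n \<noteq> 1}"
  have "psi n = (\<Sum>j\<in>A. 1)"
    unfolding psi_def inv_cyclotomic_def A_def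
    by (subst degree_prod_eq_sum_degree) auto
  also have "\<dots> = card A" by simp
  also have "A = {1..n} - totatives n"
    by (auto simp: A_def totatives_def coprime_iff_gcd_eq_1)
  also have "card \<dots> = card {1..n} - card (totatives n)"
    by (intro card_Diff_subset) (auto simp: totatives_def)
  finally show ?thesis by (simp add: totient_def)
qed

text \<open>The list \<open>es\<close> consists of the exponents
  \<open>\<nu>\<^sub>1 < \<dots> < \<nu>\<^sub>t\<close> of the nonzero terms, indexed from 0.
  The zero polynomial (\<open>t = 0\<close>) gets the value 0 by convention.\<close>

definition max_gap :: "'a::zero poly \<Rightarrow> nat" where
  "max_gap f =
     (let es = sorted_list_of_set {i. coeff f i \<noteq> 0}; t = length es in
      if t \<le> 1 then 0 else Max ((\<lambda>i. es ! Suc i - es ! i) ` {i. Suc i < t}))"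

text \<open>Only the values \<open>p 1, \<dots>, p k\<close> of \<open>p\<close> matter.\<close>

definition increasing_odd_primes :: "nat \<Rightarrow> (nat \<Rightarrow> nat) \<Rightarrow> bool" where
  "increasing_odd_primes k p \<longleftrightarrow>
     (\<forall>i\<in>{1..k}. prime (p i) \<and> odd (p i)) \<and> strict_mono_on {1..k} p"

text \<open>The first argument is the least prime factor \<open>p\<^sub>1\<close> of \<open>n\<close>.
  The value may be negative.\<close>

definition delta_minus :: "nat \<Rightarrow> nat \<Rightarrow> real" where
  "delta_minus p1 n = 2 * (real n / real p1) - real (psi n)"

end

theory Submission
  imports Defs "HOL-Library.Infinite_Set" "HOL-Real_Asymp.Real_Asymp"
begin

text \<open>
  Put \<open>N = n / p\<^sub>1\<close>. All \<open>N\<close>-th roots of unity are zeros of \<open>\<Psi>\<^sub>n\<close>, so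
  \<open>\<Psi>\<^sub>n = (x\<^sup>N - 1) G\<close> with \<open>deg G = \<psi>(n) - N\<close>, and \<open>\<delta>\<^sup>-(n) = N - deg G\<close>.
  The hypothesis on \<open>\<delta>\<^sup>-(n)\<close> says \<open>2 deg G \<le> N\<close>, so the two copies \<open>-G\<close> and \<open>x\<^sup>N G\<close> do not
  overlap, they are separated by a gap of length \<open>N - deg G\<close>, and the gaps inside each copy
  are at most \<open>deg G \<le> N - deg G\<close>.

  For the density, the hypothesis on \<open>\<delta>\<^sup>-(n)\<close> is \<open>\<phi>(n)/n \<ge> 1 - 3/(2p\<^sub>1)\<close>. As
  \<open>\<phi>(n)/n \<ge> (1 - 1/p\<^sub>1) (1 - \<Sum>\<^sub>i\<^sub>\<ge>\<^sub>2 1/p\<^sub>i)\<close>, it can only fail if one of \<open>p\<^sub>2, \<dots>, p\<^sub>k\<close> is below a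
  bound depending on \<open>k\<close> and \<open>p\<^sub>1\<close>. Excluding finitely many primes does not change the
  asymptotic number of \<open>(k-1)\<close>-subsets of the primes in \<open>(p\<^sub>1, b]\<close>.
\<close>

section \<open>The maximum gap\<close>

lemma coeff_monom_diff_one_mult:
  fixes G :: "'a::comm_ring_1 poly"
  shows "coeff ((monom 1 N - 1) * G) i = (if i < N then 0 else coeff G (i - N)) - coeff G i"
  by (simp add: left_diff_distrib coeff_monom_mult)

text \<open>The supports of \<open>-G\<close> and \<open>x^N * G\<close> are disjoint, so nothing
  cancels and the sorted exponents are those of \<open>G\<close> followed by their shifts by
  \<open>N\<close>. As \<open>0\<close> and \<open>degree G\<close> are both exponents of
  \<open>G\<close>, the jump between the blocks is exactly \<open>N - degree G\<close>.\<close>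

lemma max_gap_monom_diff_one_mult:
  fixes G :: "'a::comm_ring_1 poly"
  assumes G0: "coeff G 0 \<noteq> 0" and deg: "2 * degree G \<le> N" and N: "N \<ge> 1"
  shows "max_gap ((monom 1 N - 1) * G) = N - degree G"
proof -
  define d where "d = degree G"
  define A where "A = {i. coeff G i \<noteq> 0}"
  define L where "L = sorted_list_of_set A"
  define m where "m = length L"
  have A_le: "i \<le> d" if "i \<in> A" for i
    using that by (auto simp: A_def d_def le_degree)
  have finA: "finite A"
    by (rule finite_subset[of _ "{..d}"]) (use A_le in auto)
  \<comment> \<open>Strictness needs \<open>N >= 1\<close> only in the case
    \<open>d = 0\<close>.\<close>
  have dN: "d < N" "2 * d \<le> N" using deg N by (auto simp: d_def)
  have L: "sorted L" "distinct L" "set L = A"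
    using finA by (auto simp: L_def)
  have zA: "0 \<in> A" and dA: "d \<in> A"
    using G0 by (auto simp: A_def d_def)
  have m: "m > 0" using zA L(3) unfolding m_def by (metis length_pos_if_in_set)
  have L_le: "L ! i \<le> d" if "i < m" for i
    using that A_le L(3) nth_mem unfolding m_def by blast
  have L0: "L ! 0 = 0"
  proof -
    obtain j where "j < m" "L ! j = 0" using zA L(3) unfolding m_def by (metis in_set_conv_nth)
    then show ?thesis using sorted_nth_mono[OF L(1), of 0 j] by (simp add: m_def)
  qed
  have Ld: "L ! (m - 1) = d"
  proof -
    obtain j where "j < m" "L ! j = d" using dA L(3) unfolding m_def by (metis in_set_conv_nth)
    then show ?thesis using sorted_nth_mono[OF L(1), of j "m - 1"] L_le[of "m - 1"] m
      by (intro antisym) (auto simp: m_def)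
  qed
  define M where "M = L @ map ((+) N) L"
  have supp: "{i. coeff ((monom 1 N - 1) * G) i \<noteq> 0} = set M"
  proof -
    have "coeff G i = 0" if "i \<ge> N" for i
      using that dN(1) A_le[of i] by (auto simp: A_def)
    moreover have "i \<in> (+) N ` A \<longleftrightarrow> i \<ge> N \<and> coeff G (i - N) \<noteq> 0" for i
      by (auto simp: A_def image_iff intro!: exI[of _ "i - N"])
    ultimately show ?thesis
      unfolding M_def coeff_monom_diff_one_mult
      by (auto simp: L A_def not_less split: if_splits)
  qed
  have sep: "x < N + y" if "x \<in> A" for x y
    using A_le[OF that] dN(1) by simp
  have "sorted (map ((+) N) L)"
    using L(1) by (auto simp: sorted_iff_nth_mono)
  then have "sorted M"
    using L sep by (auto simp: M_def sorted_append intro: less_imp_le)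
  moreover have "distinct M"
    using L sep by (fastforce simp: M_def distinct_map)
  ultimately have M: "sorted_list_of_set {i. coeff ((monom 1 N - 1) * G) i \<noteq> 0} = M"
    unfolding supp by (rule sorted_list_of_set.idem_if_sorted_distinct)
  have len: "length M = 2 * m" by (simp add: M_def m_def)
  have M_lt: "M ! j = L ! j" if "j < m" for j
    using that by (simp add: M_def nth_append m_def)
  have M_ge: "M ! j = N + L ! (j - m)" if "m \<le> j" "j < 2 * m" for j
    using that by (simp add: M_def nth_append m_def)
  have mid: "M ! m - M ! (m - 1) = N - d"
    using m L0 Ld M_lt[of "m - 1"] M_ge[of m] by simp
  have "Max ((\<lambda>i. M ! Suc i - M ! i) ` {i. Suc i < 2 * m}) = N - d"
  proof (rule Max_eqI)
    show "finite ((\<lambda>i. M ! Suc i - M ! i) ` {i. Suc i < 2 * m})"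
      by (rule finite_imageI, rule finite_subset[of _ "{..<2 * m}"]) auto
    show "y \<le> N - d" if "y \<in> (\<lambda>i. M ! Suc i - M ! i) ` {i. Suc i < 2 * m}" for y
    proof -
      from that obtain i where i: "Suc i < 2 * m" and y: "y = M ! Suc i - M ! i" by blast
      \<comment> \<open>The step lies inside the first copy, between the copies, or inside the
        second copy.\<close>
      consider "Suc i < m" | "Suc i = m" | "i \<ge> m" by linarith
      then show ?thesis
      proof cases
        case 1
        then have "y \<le> d" using L_le[of "Suc i"] by (simp add: y M_lt)
        then show ?thesis using dN by simp
      next
        case 2
        then show ?thesis using mid by (auto simp: y)
      next
        case 3
        then have "y = L ! (Suc i - m) - L ! (i - m)"
          using i by (simp add: y M_ge)
        then have "y \<le> d" using L_le[of "Suc i - m"] i 3 by linarith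
        then show ?thesis using dN by simp
      qed
    qed
    from m mid show "N - d \<in> (\<lambda>i. M ! Suc i - M ! i) ` {i. Suc i < 2 * m}"
      by (intro image_eqI[of _ _ "m - 1"]) auto
  qed
  with m show ?thesis
    by (simp add: max_gap_def M len d_def)
qed

section \<open>Splitting off \<open>x^N - 1\<close> from the inverse cyclotomic polynomial\<close>

text \<open>Both sides are monic of degree \<open>N\<close>, so their difference \<open>D\<close>
  has degree below \<open>N\<close> unless it is zero; but it vanishes at \<open>N\<close> distinct
  roots of unity.\<close>

lemma prod_roots_of_unity:
  assumes "N \<ge> 1"
  shows "(\<Prod>j\<in>{1..N}. [:- exp (2 * of_real pi * \<i> * of_nat j / of_nat N), 1:]) =
           (monom 1 N - 1 :: complex poly)"
proof -
  define w :: "nat \<Rightarrow> complex" where "w j = exp (2 * of_real pi * \<i> * of_nat j / of_nat N)" for j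
  define P where "P = (\<Prod>j\<in>{1..N}. [:- w j, 1:])"
  define D where "D = P - (monom 1 N - 1)"
  have w_cis: "w j = cis (2 * pi * real j / real N)" for j
    by (simp add: w_def cis_conv_exp mult_ac)
  have inj: "inj_on w {..<N}"
    using bij_betw_roots_unity[of N] assms by (auto simp: w_cis bij_betw_def inj_on_def)
  \<comment> \<open>Multiplication by the nonzero \<open>w 1\<close> shifts the index by one, which
    carries injectivity from \<open>{..<N}\<close> to \<open>{1..N}\<close>.\<close>
  have "w 1 * w j = w (Suc j)" for j
    by (simp add: w_cis cis_mult add_divide_distrib ring_distribs)
  moreover have "inj_on (\<lambda>j. w 1 * w j) {..<N}"
    using inj by (auto simp: inj_on_def w_def)
  ultimately have "inj_on (w \<circ> Suc) {..<N}" by (simp add: o_def)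
  then have "inj_on w (Suc ` {..<N})" by (metis inj_on_imageI)
  moreover have "Suc ` {..<N} = {1..N}" by (simp add: lessThan_atLeast0 atLeastLessThanSuc_atLeastAtMost)
  ultimately have inj': "inj_on w {1..N}" by simp
  have wN: "w j ^ N = 1" for j
    using assms cis_multiple_2pi[of "real j"] by (simp add: w_cis DeMoivre mult_ac)
  have degP: "degree P = N"
    unfolding P_def by (subst degree_prod_eq_sum_degree) auto
  have lcP: "coeff P N = 1"
    using lead_coeff_prod[of "\<lambda>j. [:- w j, 1:]" "{1..N}"] degP by (simp add: P_def)
  have deg1: "degree (monom 1 N - 1 :: complex poly) \<le> N"
    by (rule degree_diff_le) (auto simp: degree_monom_eq)
  have "D = 0"
  proof (rule ccontr)
    assume D: "D \<noteq> 0"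
    have "coeff D N = 0" using assms lcP by (simp add: D_def)
    moreover have "degree D \<le> N" using degP deg1 unfolding D_def by (simp add: degree_diff_le)
    ultimately have "degree D < N"
      using D by (metis le_neq_implies_less leading_coeff_0_iff)
    moreover have "w ` {1..N} \<subseteq> {x. poly D x = 0}"
      using wN by (fastforce simp: D_def P_def poly_prod poly_monom)
    then have "card (w ` {1..N}) \<le> card {x. poly D x = 0}"
      by (rule card_mono[OF poly_roots_finite[OF D]])
    then have "N \<le> degree D"
      using card_poly_roots_bound[OF D] card_image[OF inj'] by simp
    ultimately show False by simp
  qed
  then show ?thesis by (simp add: D_def P_def w_def)
qed

text \<open>The multiples of \<open>r\<close> up to \<open>n\<close> are not coprime to
  \<open>n\<close>, and their roots of unity are precisely the \<open>N\<close>-th ones for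
  \<open>N = n div r\<close>. \<open>G\<close> collects the remaining linear factors; none of them
  has the root \<open>0\<close>.\<close>

lemma monom_diff_one_factor_inv_cyclotomic:
  assumes n: "n \<ge> 1" and r: "r dvd n" "r > 1"
  obtains G where "inv_cyclotomic n = (monom 1 (n div r) - 1) * G" "coeff G 0 \<noteq> 0"
    "psi n = n div r + degree G"
proof -
  define N where "N = n div r"
  have nN: "n = r * N" using r by (simp add: N_def)
  have N: "N \<ge> 1" using n nN by (cases N) auto
  define f :: "nat \<Rightarrow> complex poly"
    where "f j = [:- exp (2 * of_real pi * \<i> * of_nat j / of_nat n), 1:]" for j
  define J where "J = {j. 1 \<le> j \<and> j \<le> n \<and> gcd j n \<noteq> 1}"
  define K where "K = (*) r ` {1..N}"
  define G where "G = (\<Prod>j\<in>J - K. f j)"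
  have finJ: "finite J" by (auto simp: J_def)
  have "gcd (r * i) n \<noteq> 1" for i
    using r by (metis coprime_iff_gcd_eq_1 coprime_def dvd_triv_left less_irrefl nat_dvd_1_iff_1)
  then have KJ: "K \<subseteq> J"
    using r(2) by (auto simp: K_def J_def nN)
  have "(\<Prod>j\<in>K. f j) = (\<Prod>i\<in>{1..N}. f (r * i))"
    unfolding K_def using r(2) by (subst prod.reindex) (auto simp: inj_on_def)
  also have "\<dots> = (\<Prod>j\<in>{1..N}. [:- exp (2 * of_real pi * \<i> * of_nat j / of_nat N), 1:])"
    using r(2) by (intro prod.cong refl) (simp add: f_def nN mult_ac)
  also have "\<dots> = monom 1 N - 1" using N by (rule prod_roots_of_unity)
  finally have fK: "(\<Prod>j\<in>K. f j) = monom 1 N - 1" .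
  have inv: "inv_cyclotomic n = (\<Prod>j\<in>J. f j)"
    by (simp add: inv_cyclotomic_def J_def f_def)
  have eq: "inv_cyclotomic n = (monom 1 N - 1) * G"
    using prod.subset_diff[OF KJ finJ, of f] fK by (simp add: inv G_def mult_ac)
  have G0: "coeff G 0 \<noteq> 0"
    by (simp add: G_def f_def finJ poly_prod flip: poly_0_coeff_0)
  have "degree G = card J - card K"
    unfolding G_def f_def using finJ KJ
    by (subst degree_prod_eq_sum_degree) (auto simp: card_Diff_subset finite_subset)
  moreover have "card K = N"
    unfolding K_def using r(2) by (subst card_image) (auto simp: inj_on_def)
  moreover have "psi n = card J"
    unfolding psi_def inv f_def by (subst degree_prod_eq_sum_degree) auto
  moreover have "card K \<le> card J" using KJ finJ by (rule card_mono[rotated])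
  ultimately have "psi n = N + degree G" by simp
  with eq G0 show ?thesis by (intro that) (simp_all add: N_def)
qed

lemma max_gap_inv_cyclotomic:
  assumes n: "n \<ge> 1" and r: "r dvd n" "r > 1"
    and delta: "delta_minus r n \<ge> 1/2 * (real n / real r)"
  shows "real (max_gap (inv_cyclotomic n)) = delta_minus r n"
proof -
  define N where "N = n div r"
  obtain G where G: "inv_cyclotomic n = (monom 1 N - 1) * G" "coeff G 0 \<noteq> 0"
    "psi n = N + degree G"
    using monom_diff_one_factor_inv_cyclotomic[OF n r] unfolding N_def by blast
  have nr: "real n / real r = real N" using r by (simp add: N_def real_of_nat_div)
  have dm: "delta_minus r n = real N - real (degree G)"
    by (simp add: delta_minus_def nr G(3))
  have deg: "2 * degree G \<le> N"
    using delta unfolding dm nr by linarith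
  have N: "N \<ge> 1" using n r by (auto simp: N_def Suc_le_eq div_greater_zero_iff dvd_imp_le)
  show ?thesis
    using max_gap_monom_diff_one_mult[OF G(2) deg N] deg by (simp add: G(1) dm of_nat_diff)
qed

section \<open>The density\<close>

lemma primes_upto_finite [simp]: "finite {p::nat. prime p \<and> a < p \<and> real p \<le> b}"
  by (rule finite_subset[of _ "{..nat \<lfloor>b\<rfloor>}"]) (auto simp: le_nat_floor)

text \<open>Reduces counting \<open>n\<close> to counting subsets: the primes above the smallest one
  form a set \<open>S\<close>, and sorting \<open>insert q S\<close> recovers the sequence.\<close>

lemma increasing_odd_primes_products_eq:
  assumes k: "k \<ge> 2" and q: "prime q" "odd q"
  shows "{n. \<exists>p. increasing_odd_primes k p \<and> n = (\<Prod>i=1..k. p i) \<and> real (p k) \<le> b \<and> p 1 = q} =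
    (\<lambda>S. q * \<Prod>S) ` {S. S \<subseteq> {p. prime p \<and> q < p \<and> real p \<le> b} \<and> card S = k - 1}"
    (is "?L = ?R")
proof (intro equalityI subsetI)
  fix n assume "n \<in> ?L"
  then obtain p where p: "\<And>i. i \<in> {1..k} \<Longrightarrow> prime (p i)" "strict_mono_on {1..k} p"
    "n = (\<Prod>i=1..k. p i)" "real (p k) \<le> b" "p 1 = q"
    unfolding increasing_odd_primes_def mem_Collect_eq by blast
  have inj: "inj_on p {1..k}" using p(2) by (rule strict_mono_on_imp_inj_on)
  define S where "S = p ` {2..k}"
  have inj2: "inj_on p {2..k}" using inj by (rule inj_on_subset) auto
  have "{1..k} = insert 1 {2..k}" using k by auto
  then have "n = q * \<Prod>S" using p(3,5) by (simp add: S_def prod.reindex[OF inj2])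
  moreover have "card S = k - 1" by (simp add: S_def card_image[OF inj2])
  moreover have "prime (p i) \<and> q < p i \<and> real (p i) \<le> b" if "i \<in> {2..k}" for i
  proof -
    have "p i \<le> p k" using strict_mono_onD[OF p(2), of i k] that by (cases "i = k") auto
    then show ?thesis
      using p(1)[of i] p(4,5) strict_mono_onD[OF p(2), of 1 i] that by auto
  qed
  then have "S \<subseteq> {p. prime p \<and> q < p \<and> real p \<le> b}" by (auto simp: S_def)
  ultimately show "n \<in> ?R" by blast
next
  fix n assume "n \<in> ?R"
  then obtain S where S: "S \<subseteq> {p. prime p \<and> q < p \<and> real p \<le> b}" "card S = k - 1" "n = q * \<Prod>S"
    by blast
  have finS: "finite S" using S(1) by (rule finite_subset) simp
  have qS: "q \<notin> S" using S(1) by auto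
  have card: "card (insert q S) = k" using finS qS S(2) k by simp
  obtain h where h: "bij_betw h {..<k} (insert q S)" "strict_mono_on {..<k} h"
    using ex_bij_betw_strict_mono_card[of "insert q S"] finS card by auto
  have h0: "h 0 = q"
  proof -
    obtain j where j: "j < k" "h j = q"
      using h(1) by (metis bij_betw_iff_bijections insertI1 lessThan_iff)
    have "h 0 \<in> insert q S" using h(1) k by (auto simp: bij_betw_def)
    then have "q \<le> h 0" using S(1) by auto
    then show ?thesis using strict_mono_onD[OF h(2), of 0 j] j by (cases "j = 0") auto
  qed
  \<comment> \<open>\<open>h\<close> enumerates from \<open>0\<close>, whereas the sequence starts
    at index \<open>1\<close>.\<close>
  define p where "p i = h (i - 1)" for i
  have hmem: "h i \<in> insert q S" if "i < k" for i
    using h(1) that by (auto simp: bij_betw_def)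
  \<comment> \<open>By \<open>k >= 2\<close> the largest entry lies in \<open>S\<close>, whose
    elements are bounded by \<open>b\<close>; no such bound is known for \<open>q\<close>.\<close>
  have "h (k - 1) \<noteq> q" using strict_mono_onD[OF h(2), of 0 "k - 1"] k h0 by auto
  then have "real (p k) \<le> b" using hmem[of "k - 1"] k S(1) by (auto simp: p_def)
  moreover have "prime (p i) \<and> odd (p i)" if "i \<in> {1..k}" for i
  proof -
    have pi: "p i \<in> insert q S" using hmem[of "i - 1"] that by (auto simp: p_def)
    then have "prime (p i)" "q \<le> p i" using S(1) q by auto
    moreover have "q > 2" using q prime_ge_2_nat[of q] by (cases "q = 2") auto
    ultimately show ?thesis using prime_odd_nat[of "p i"] by auto
  qed
  moreover have "strict_mono_on {1..k} p"
    unfolding strict_mono_on_def p_def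
    by (intro allI impI strict_mono_onD[OF h(2)]) auto
  moreover have "(\<Prod>i=1..k. p i) = n"
  proof -
    have "(\<Prod>i=1..k. p i) = (\<Prod>i<k. h i)"
      by (rule prod.reindex_bij_witness[of _ Suc "\<lambda>i. i - 1"]) (auto simp: p_def)
    also have "\<dots> = \<Prod>(insert q S)" by (rule prod.reindex_bij_betw[OF h(1)])
    finally show ?thesis using finS qS S(3) by simp
  qed
  moreover have "p 1 = q" by (simp add: p_def h0)
  ultimately show "n \<in> ?L" unfolding increasing_odd_primes_def by blast
qed

lemma prime_factors_prime_mult_prod:
  assumes "prime (q::nat)" "finite S" "\<And>p. p \<in> S \<Longrightarrow> prime p"
  shows "prime_factors (q * \<Prod>S) = insert q S"
proof -
  have "prime_factors (\<Prod>S) = S"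
    using assms(2,3) by (subst prime_factors_prod) (force simp: prime_prime_factors)+
  moreover have "\<Prod>S \<noteq> 0" using assms(2,3) by (auto dest: prime_gt_0_nat)
  ultimately show ?thesis using assms(1)
    by (subst prime_factors_product) (auto simp: prime_prime_factors)
qed

text \<open>Unique factorization recovers \<open>insert q S\<close> from the product, and
  \<open>q\<close> is not in \<open>S\<close>. Hence counting products is counting sets.\<close>

lemma inj_on_prime_mult_prod:
  assumes "prime (q::nat)"
  shows "inj_on (\<lambda>S. q * \<Prod>S) {S. S \<subseteq> {p. prime p \<and> q < p \<and> real p \<le> b} \<and> Q S}"
proof (rule inj_onI)
  fix S T
  assume S: "S \<in> {S. S \<subseteq> {p. prime p \<and> q < p \<and> real p \<le> b} \<and> Q S}"
    and T: "T \<in> {S. S \<subseteq> {p. prime p \<and> q < p \<and> real p \<le> b} \<and> Q S}"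
    and eq: "q * \<Prod>S = q * \<Prod>T"
  have "prime_factors (q * \<Prod>U) = insert q U \<and> q \<notin> U"
    if "U \<subseteq> {p. prime p \<and> q < p \<and> real p \<le> b}" for U
    using that assms finite_subset[OF that]
    by (subst prime_factors_prime_mult_prod) auto
  with S T eq show "S = T" by (metis (no_types, lifting) insert_ident mem_Collect_eq)
qed

section \<open>A lower bound for \<open>delta_minus\<close>\<close>

text \<open>The Weierstrass product inequality, used with \<open>a p = 1 / p\<close> to bound the
  Euler product of the totient from below.\<close>

lemma one_minus_sum_le_prod:
  fixes a :: "'b \<Rightarrow> real"
  assumes "finite S" "\<And>x. x \<in> S \<Longrightarrow> 0 \<le> a x \<and> a x \<le> 1"
  shows "1 - (\<Sum>x\<in>S. a x) \<le> (\<Prod>x\<in>S. 1 - a x)"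
  using assms
proof (induction S rule: finite_induct)
  case (insert x S)
  have "(1 - sum a S) - a x \<le> prod (\<lambda>x. 1 - a x) S - a x"
    using insert by simp
  also have "\<dots> \<le> prod (\<lambda>x. 1 - a x) S - a x * prod (\<lambda>x. 1 - a x) S"
    using insert.prems by (auto intro!: mult_left_le prod_le_1)
  finally show ?case using insert by (simp add: algebra_simps)
qed simp

text \<open>The threshold \<open>2 * q * r\<close> makes the \<open>r\<close> reciprocals sum to at
  most \<open>1 / (2 * q)\<close>. Then \<open>totient n / n\<close> is at least
  \<open>(1 - 1/q) * (1 - 1/(2*q))\<close>, which exceeds \<open>1 - 3/(2*q)\<close> by
  \<open>1/(2*q^2)\<close>.\<close>

lemma delta_minus_large_if_large_primes:
  assumes q: "prime q" and r: "r \<ge> 1" and card: "card S = r"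
    and S: "\<And>p. p \<in> S \<Longrightarrow> prime p \<and> 2 * q * r < p"
  shows "delta_minus q (q * \<Prod>S) \<ge> 1/2 * (real (q * \<Prod>S) / real q)"
proof -
  define n where "n = q * \<Prod>S"
  have finS: "finite S" using card r by (intro card_ge_0_finite) simp
  have q0: "q > 0" using q by (rule prime_gt_0_nat)
  have n: "n \<ge> 1" using finS S q0 by (auto simp: n_def Suc_le_eq intro!: prod_pos dest!: prime_gt_0_nat)
  \<comment> \<open>The threshold is at least \<open>q\<close>, so \<open>q\<close> is not in
    \<open>S\<close> and its Euler factor splits off.\<close>
  have qr: "q \<le> 2 * q * r" using r by simp
  have qS: "q \<notin> S" using S[of q] qr by auto
  have "(\<Sum>p\<in>S. 1 / real p) \<le> (\<Sum>p\<in>S. 1 / real (2 * q * r))"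
  proof (rule sum_mono)
    fix p assume "p \<in> S"
    then have "2 * q * r < p" using S by blast
    then have "real (2 * q * r) \<le> real p" by linarith
    moreover have "0 < real (2 * q * r)" using q0 r by simp
    ultimately show "1 / real p \<le> 1 / real (2 * q * r)"
      by (intro divide_left_mono mult_pos_pos) auto
  qed
  also have "\<dots> = 1 / (2 * real q)" using card r q0 by (simp add: field_simps)
  finally have "1 - 1 / (2 * real q) \<le> 1 - (\<Sum>p\<in>S. 1 / real p)" by simp
  also have "\<dots> \<le> (\<Prod>p\<in>S. 1 - 1 / real p)"
    using finS S by (intro one_minus_sum_le_prod) (auto dest!: prime_ge_1_nat simp: divide_le_eq_1)
  finally have "(1 - 1 / real q) * (1 - 1 / (2 * real q)) \<le> (1 - 1 / real q) * (\<Prod>p\<in>S. 1 - 1 / real p)"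
    using q0 by (intro mult_left_mono) auto
  also have "\<dots> = (\<Prod>p\<in>prime_factors n. 1 - 1 / real p)"
    using q finS S qS by (simp add: n_def prime_factors_prime_mult_prod)
  finally have "(1 - 1 / real q) * (1 - 1 / (2 * real q)) \<le> (\<Prod>p\<in>prime_factors n. 1 - 1 / real p)" .
  moreover have "1 - 3 / (2 * real q) \<le> (1 - 1 / real q) * (1 - 1 / (2 * real q))"
    using q0 by (simp add: field_simps)
  ultimately have "1 - 3 / (2 * real q) \<le> (\<Prod>p\<in>prime_factors n. 1 - 1 / real p)"
    by (rule order_trans[rotated])
  then have "real n * (1 - 3 / (2 * real q)) \<le> real (totient n)"
    unfolding totient_formula2 by (rule mult_left_mono) simp
  moreover have "real (psi n) = real n - real (totient n)"
    using n by (simp add: psi_eq_minus_totient totient_le of_nat_diff)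
  \<comment> \<open>Here
    \<open>2*n/q - n + totient n >= 2*n/q - 3*n/(2*q) = n/(2*q)\<close>.\<close>
  ultimately have "delta_minus q n \<ge> 1/2 * (real n / real q)"
    unfolding delta_minus_def by (simp add: field_simps)
  then show ?thesis by (simp add: n_def)
qed

section \<open>Asymptotics of the counts\<close>

text \<open>The quotient is eventually a product of the fixed number \<open>r\<close> of factors,
  each tending to 1. This is why excluding \<open>c\<close> primes does not affect the
  density.\<close>

lemma binomial_shift_ratio_tendsto:
  "((\<lambda>M. real ((M - c) choose r) / real (M choose r)) \<longlongrightarrow> 1) at_top"
proof (rule Lim_transform_eventually)
  have "((\<lambda>M. (real M - real c - real i) / (real M - real i)) \<longlongrightarrow> 1) at_top" for i
    by real_asymp
  then have "((\<lambda>M. \<Prod>i=0..<r. (real M - real c - real i) / (real M - real i)) \<longlongrightarrow> (\<Prod>i=0..<r. 1)) at_top"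
    by (intro tendsto_prod) auto
  then show "((\<lambda>M. \<Prod>i=0..<r. (real M - real c - real i) / (real M - real i)) \<longlongrightarrow> 1) at_top"
    by simp
  show "\<forall>\<^sub>F M in at_top. (\<Prod>i=0..<r. (real M - real c - real i) / (real M - real i)) =
          real ((M - c) choose r) / real (M choose r)"
    \<comment> \<open>From here on every natural subtraction is exact and every denominator is
      positive.\<close>
    using eventually_ge_at_top[of "c + r"]
  proof eventually_elim
    case (elim M)
    then have "real ((M - c) choose r) / real (M choose r) =
        (\<Prod>i=0..<r. (real (M - c - i) / real (r - i)) / (real (M - i) / real (r - i)))"
      by (simp add: binomial_altdef_of_nat prod_dividef)
    also have "\<dots> = (\<Prod>i=0..<r. (real M - real c - real i) / (real M - real i))"
      using elim by (intro prod.cong refl) (auto simp: of_nat_diff)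
    finally show ?case by simp
  qed
qed

lemma card_primes_greater_at_top:
  "filterlim (\<lambda>b::real. card {p. prime p \<and> (q::nat) < p \<and> real p \<le> b}) at_top at_top"
  unfolding filterlim_at_top
proof
  fix Z :: nat
  have "infinite ({p::nat. prime p} - {..q})"
    using primes_infinite by (simp add: Diff_infinite_finite)
  then obtain F where F: "finite F" "card F = Z" "F \<subseteq> {p::nat. prime p} - {..q}"
    by (metis infinite_arbitrarily_large)
  show "\<forall>\<^sub>F b in at_top. Z \<le> card {p. prime p \<and> q < p \<and> real p \<le> b}"
    \<comment> \<open>The sum serves as an upper bound for all elements of \<open>F\<close>.\<close>
    using eventually_ge_at_top[of "real (\<Sum>F)"]
  proof eventually_elim
    case (elim b)
    have "real p \<le> b" if "p \<in> F" for p
      using member_le_sum[of p F real] that F(1) elim by simp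
    then have "F \<subseteq> {p. prime p \<and> q < p \<and> real p \<le> b}" using F(3) by auto
    then show ?case using card_mono[OF primes_upto_finite] F(2) by metis
  qed
qed

text \<open>Every \<open>r\<close>-subset of the primes in \<open>(B, b]\<close> yields a good
  \<open>n\<close>. The density is thus squeezed between 1 and a quotient of binomial coefficients
  whose upper arguments differ by the number \<open>c\<close> of primes in \<open>(q, B]\<close>,
  which is independent of \<open>b\<close>.\<close>

lemma large_delta_minus_density:
  assumes k: "k \<ge> 2" and q: "prime q" "odd q"
  shows "((\<lambda>b::real.
      real (card {n. \<exists>p. increasing_odd_primes k p \<and> n = (\<Prod>i=1..k. p i) \<and>
                         real (p k) \<le> b \<and> p 1 = q \<and>
                         delta_minus (p 1) n \<ge> 1/2 * (real n / real (p 1))})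
    / real (card {n. \<exists>p. increasing_odd_primes k p \<and> n = (\<Prod>i=1..k. p i) \<and>
                         real (p k) \<le> b \<and> p 1 = q})) \<longlongrightarrow> 1) at_top"
    (is "((\<lambda>b. real (card (?G b)) / real (card (?T b))) \<longlongrightarrow> 1) at_top")
proof -
  define r where "r = k - 1"
  define B where "B = 2 * q * r"
  define P :: "nat \<Rightarrow> real \<Rightarrow> nat set" where "P a b = {p. prime p \<and> a < p \<and> real p \<le> b}" for a b
  define c where "c = card (P q (real B))"
  define f where "f S = q * \<Prod>S" for S :: "nat set"
  have r: "r \<ge> 1" using k by (simp add: r_def)
  have finP: "finite (P a b)" for a b by (simp add: P_def)
  have T: "?T b = f ` {S. S \<subseteq> P q b \<and> card S = r}" for b
    unfolding increasing_odd_primes_products_eq[OF k q] by (simp add: f_def P_def r_def)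
  have inj: "inj_on f {S. S \<subseteq> P q b \<and> card S = r}" for b
    unfolding f_def P_def using q(1) by (rule inj_on_prime_mult_prod)
  have cardT: "card (?T b) = card (P q b) choose r" for b
    unfolding T card_image[OF inj] using finP by (rule n_subsets)
  have finT: "finite (?T b)" for b
    unfolding T using finP by simp
  have G: "?G b = {n \<in> ?T b. delta_minus q n \<ge> 1/2 * (real n / real q)}" for b
    by auto
  have GT: "card (?G b) \<le> card (?T b)" for b
    unfolding G by (rule card_mono[OF finT]) auto
  have cardG: "(card (P q b) - c) choose r \<le> card (?G b)" for b
  proof -
    have sub: "P B b \<subseteq> P q b" using r by (auto simp: P_def B_def intro: le_less_trans[rotated])
    have "f S \<in> ?G b" if S: "S \<subseteq> P B b" "card S = r" for S
    proof -
      have "delta_minus q (f S) \<ge> 1/2 * (real (f S) / real q)"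
        unfolding f_def using S
        by (intro delta_minus_large_if_large_primes[OF q(1) r]) (auto simp: P_def B_def)
      moreover have "f S \<in> ?T b" unfolding T using S sub by blast
      ultimately show ?thesis unfolding G by simp
    qed
    then have "f ` {S. S \<subseteq> P B b \<and> card S = r} \<subseteq> ?G b" by blast
    moreover have "finite (?G b)" unfolding G using finT by simp
    ultimately have "card (f ` {S. S \<subseteq> P B b \<and> card S = r}) \<le> card (?G b)"
      by (rule card_mono[rotated])
    moreover have "inj_on f {S. S \<subseteq> P B b \<and> card S = r}"
      using inj[of b] by (rule inj_on_subset) (use sub in auto)
    ultimately have *: "card (P B b) choose r \<le> card (?G b)"
      by (simp add: card_image n_subsets[OF finP])
    have "P q b \<subseteq> P q (real B) \<union> P B b" by (auto simp: P_def)
    then have "card (P q b) \<le> c + card (P B b)"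
      unfolding c_def by (meson card_Un_le card_mono finP finite_UnI le_trans)
    then have "(card (P q b) - c) choose r \<le> card (P B b) choose r"
      by (intro binomial_right_mono) simp
    with * show ?thesis by simp
  qed
  have lim: "filterlim (\<lambda>b. card (P q b)) at_top at_top"
    unfolding P_def by (rule card_primes_greater_at_top)
  \<comment> \<open>For small \<open>b\<close> there may be no \<open>n\<close> at all; the quotient
    is then \<open>0\<close> by the convention for division by zero.\<close>
  have le1: "real x / real y \<le> 1" if "x \<le> y" for x y
    using that by (cases "y = 0") auto
  show ?thesis
  proof (rule tendsto_sandwich)
    show "((\<lambda>b. real ((card (P q b) - c) choose r) / real (card (P q b) choose r)) \<longlongrightarrow> 1) at_top"
      by (rule filterlim_compose[OF binomial_shift_ratio_tendsto lim])
    show "\<forall>\<^sub>F b in at_top. real ((card (P q b) - c) choose r) / real (card (P q b) choose r)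
        \<le> real (card (?G b)) / real (card (?T b))"
      unfolding cardT using cardG by (intro always_eventually allI divide_right_mono) auto
    show "\<forall>\<^sub>F b in at_top. real (card (?G b)) / real (card (?T b)) \<le> 1"
      by (intro always_eventually allI le1 GT)
  qed simp
qed

theorem theorem6:
  shows "(\<forall>(k::nat) (p::nat \<Rightarrow> nat) (n::nat).
            k \<ge> 1 \<longrightarrow> increasing_odd_primes k p \<longrightarrow> n = (\<Prod>i=1..k. p i) \<longrightarrow>
            delta_minus (p 1) n \<ge> 1/2 * (real n / real (p 1)) \<longrightarrow>
            real (max_gap (inv_cyclotomic n)) = delta_minus (p 1) n) \<and>
         (\<forall>(k::nat) (q::nat). k \<ge> 2 \<longrightarrow> prime q \<longrightarrow> odd q \<longrightarrow>
            ((\<lambda>b::real.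
                real (card {n. \<exists>p. increasing_odd_primes k p \<and> n = (\<Prod>i=1..k. p i) \<and>
                                   real (p k) \<le> b \<and> p 1 = q \<and>
                                   delta_minus (p 1) n \<ge> 1/2 * (real n / real (p 1))})
              / real (card {n. \<exists>p. increasing_odd_primes k p \<and> n = (\<Prod>i=1..k. p i) \<and>
                                   real (p k) \<le> b \<and> p 1 = q}))
             \<longlongrightarrow> 1) at_top)"
proof (intro conjI allI impI)
  fix k n :: nat and p :: "nat \<Rightarrow> nat"
  assume k: "k \<ge> 1" and inc: "increasing_odd_primes k p" and n: "n = (\<Prod>i=1..k. p i)"
    and delta: "delta_minus (p 1) n \<ge> 1/2 * (real n / real (p 1))"
  have prime: "prime (p i)" if "i \<in> {1..k}" for i
    using inc that by (auto simp: increasing_odd_primes_def)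
  have "n > 0" unfolding n using prime by (intro prod_pos) (auto dest: prime_gt_0_nat)
  moreover have "p 1 dvd n" unfolding n using k by (intro dvd_prodI) auto
  moreover have "p 1 > 1" using prime[of 1] k by (intro prime_gt_1_nat) simp
  ultimately show "real (max_gap (inv_cyclotomic n)) = delta_minus (p 1) n"
    using delta by (intro max_gap_inv_cyclotomic) auto
qed (rule large_delta_minus_density)

end
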